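(* Let $x_1,x_2,x_3,u,\lambda\in\mathbb{C}$ and put $e_1=x_1+x_2+x_3$. Suppose $\operatorname{Re}(\lambda+u-e_1)>0$. For integers $k\ge0$ let $$\eta_k^\pm=\frac{e_1+k}{2}\pm\sqrt{\frac{(e_1+k-2\lambda)^2}{4}+\frac{(x_1-\lambda)(x_2-\lambda)(x_3-\lambda)}{\lambda+k}}.$$ Assume that $x_1,x_2,x_3,\lambda$ are not non-positive integers and that, for every integer $k\ge 0$, neither $\eta_k^+$ nor $\eta_k^-$ is a non-positive integer. Then $$\frac{\Gamma(x_1)\Gamma(x_2)\Gamma(x_3)}{\Gamma(u-x_1)\Gamma(u-x_2)\Gamma(u-x_3)}=\sum_{k=0}^\infty\frac{(-1)^k}{k!}\,\frac{\Gamma(\eta_k^+)\,\Gamma(\eta_k^-)}{\Gamma(u+k)\,\Gamma(u-\eta_k^+)\,\Gamma(u-\eta_k^-)}\left(\sum_{j=1}^3\frac{1}{x_j+k}-\frac{1}{\lambda+k}\right).$$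
   Context: The reciprocal gamma function $1/\Gamma$ is understood as an entire function (equal to $0$ at the non-positive integers). The choice of square root in $\eta_k^\pm$ is immaterial, since the expressions are symmetric in $\eta_k^+$ and $\eta_k^-$. *)

theory Defs
  imports "HOL-Analysis.Analysis"
begin

definition eta_disc :: "complex \<Rightarrow> complex \<Rightarrow> complex \<Rightarrow> complex \<Rightarrow> nat \<Rightarrow> complex" where
  "eta_disc x1 x2 x3 l k =
     (x1 + x2 + x3 + of_nat k - 2 * l)\<^sup>2 / 4
       + (x1 - l) * (x2 - l) * (x3 - l) / (l + of_nat k)"

text \<open>
  The principal square root is used; the choice of branch only permutes the two values below.
\<close>

definition eta_plus :: "complex \<Rightarrow> complex \<Rightarrow> complex \<Rightarrow> complex \<Rightarrow> nat \<Rightarrow> complex" where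
  "eta_plus x1 x2 x3 l k =
     (x1 + x2 + x3 + of_nat k) / 2 + csqrt (eta_disc x1 x2 x3 l k)"

definition eta_minus :: "complex \<Rightarrow> complex \<Rightarrow> complex \<Rightarrow> complex \<Rightarrow> nat \<Rightarrow> complex" where
  "eta_minus x1 x2 x3 l k =
     (x1 + x2 + x3 + of_nat k) / 2 - csqrt (eta_disc x1 x2 x3 l k)"

end

theory Submission
  imports Defs "HOL-Computational_Algebra.Polynomial"
begin

text \<open>
  Put \<open>e = x1 + x2 + x3\<close> and \<open>P t = (t - x1) * (t - x2) * (t - x3)\<close>. The triple \<open>- k\<close>, \<open>ep k\<close>, \<open>em k\<close> formed with the two
  eta values has the same sum as \<open>x1\<close>, \<open>x2\<close>, \<open>x3\<close>, and the monic cubic with these roots has the same value at \<open>l\<close>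
  as \<open>P\<close>. Hence the triple consists of the roots of a member of the pencil \<open>P t + w * (t - l)\<close>, namely the one
  with parameter \<open>w = w k = P (- k) / (l + k)\<close>.

  The product of \<open>Gamma x / Gamma (u - x)\<close> over the three roots \<open>x\<close> of a member is a symmetric function of the
  roots, and therefore a meromorphic function of \<open>w\<close>. Its poles are among the points \<open>w k\<close>, and the
  claimed series is its partial fraction expansion, evaluated at \<open>w = 0\<close>. The condition on the real part says that
  this function has no contribution from infinity.

  The proof makes this precise without contour integrals. By Euler's product, the function is the limit as
  \<open>n\<close> tends to infinity of \<open>n\<close> to the power \<open>2 * e - 3 * u\<close> times the product over \<open>m \<le> n\<close> of
  \<open>(P (u + m) + w * (u + m - l)) / (- P (- m) + w * (m + l))\<close>. Each factor is linear fractional in \<open>w\<close>, so for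
  finite \<open>n\<close> the partial fraction expansion is an algebraic identity (\<open>finite_expansion\<close>). In it, the left
  side tends to the gamma product (\<open>value_at_zero_limit\<close>), the constant term behaves like \<open>n\<close> to the power
  \<open>- 2 * (l + u - e)\<close> and vanishes in the limit (\<open>value_at_infinity_limit\<close>), and each residue term tends to the
  corresponding term of the series (\<open>term_limit\<close>).

  Limit and sum may be interchanged by Tannery's theorem, since for large \<open>k\<close> the residue terms are bounded by a
  constant times \<open>k\<close> to the power \<open>- 1 - 2 * Re (l + u - e)\<close>, uniformly in \<open>n\<close> (\<open>term_bound\<close>). This bound comes from
  the first-order expansion of each factor of the product (\<open>factor_quotient_bound\<close>), whose sum over \<open>m\<close> is a
  combination of harmonic numbers (\<open>exponent_sum_bound\<close>).
\<close>

section \<open>Partial fractions for quotients of products of linear factors\<close>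

text \<open>
  Both sides are the value at \<open>w = 0\<close> of the rational function
  \<open>(\<Prod>i\<in>I. a i + b i * w) / (\<Prod>i\<in>I. c i + d i * w)\<close>. It has simple poles at the points
  \<open>w i = - c i / d i\<close> and the finite value \<open>(\<Prod>i\<in>I. b i) / (\<Prod>i\<in>I. d i)\<close> at infinity. After
  clearing denominators its partial fraction expansion equates two polynomials of degree at most
  \<open>card I\<close>, which have the same coefficient in degree \<open>card I\<close> and agree at the \<open>card I\<close> poles.
\<close>

lemma partial_fractions_linear_products:
  fixes a b c d :: "nat \<Rightarrow> 'a :: field"
  defines "w \<equiv> (\<lambda>i. - c i / d i)"
  assumes I: "finite I" and d: "\<And>i. i \<in> I \<Longrightarrow> d i \<noteq> 0" and c: "\<And>i. i \<in> I \<Longrightarrow> c i \<noteq> 0"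
    and inj: "inj_on w I"
  shows "(\<Prod>i\<in>I. a i) / (\<Prod>i\<in>I. c i) = (\<Prod>i\<in>I. b i) / (\<Prod>i\<in>I. d i) +
    (\<Sum>k\<in>I. (\<Prod>i\<in>I. a i + b i * w k) / (c k * (\<Prod>i\<in>I-{k}. c i + d i * w k)))"
proof -
  define q where "q = (\<Prod>i\<in>I. [:a i, b i:])"
  define G where "G = (\<lambda>J. \<Prod>i\<in>J. [:c i, d i:])"
  define \<beta> where "\<beta> = (\<Prod>i\<in>I. b i) / (\<Prod>i\<in>I. d i)"
  define \<rho> where "\<rho> = (\<lambda>k. poly q (w k) / poly (G (I - {k})) (w k))"
  have prod_deg: "degree (\<Prod>i\<in>J. [:f i, g i:]) \<le> card J"
    and prod_lead: "coeff (\<Prod>i\<in>J. [:f i, g i:]) (card J) = (\<Prod>i\<in>J. g i)"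
    if "finite J" for f g :: "nat \<Rightarrow> 'a" and J
  proof -
    have "degree (\<Prod>i\<in>J. [:f i, g i:]) \<le> card J \<and>
        coeff (\<Prod>i\<in>J. [:f i, g i:]) (card J) = (\<Prod>i\<in>J. g i)"
      using that
    proof (induction J rule: finite_induct)
      case (insert j J)
      have "coeff (\<Prod>i\<in>J. [:f i, g i:]) (Suc (card J)) = 0"
        using insert by (intro coeff_eq_0) auto
      moreover have "degree ([:f j, g j:] * (\<Prod>i\<in>J. [:f i, g i:])) \<le> 1 + card J"
        using insert by (intro order.trans[OF degree_mult_le] add_mono) auto
      ultimately show ?case using insert by simp
    qed auto
    then show "degree (\<Prod>i\<in>J. [:f i, g i:]) \<le> card J"
      "coeff (\<Prod>i\<in>J. [:f i, g i:]) (card J) = (\<Prod>i\<in>J. g i)" by auto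
  qed
  have G_vanish: "poly (G (I - {k})) (w j) = 0" if "j \<in> I" "k \<in> I" "j \<noteq> k" for j k
    using that I d[OF that(1)] by (auto simp: G_def poly_prod w_def intro!: prod_zero bexI[of _ j])
  have G_nonzero: "poly (G (I - {k})) (w k) \<noteq> 0" if "k \<in> I" for k
  proof -
    have "c i + d i * w k \<noteq> 0" if "i \<in> I - {k}" for i
    proof
      assume "c i + d i * w k = 0"
      then have "w k = w i" using d[of i] that by (simp add: w_def field_simps eq_neg_iff_add_eq_0)
      then show False using inj that \<open>k \<in> I\<close> by (auto dest: inj_onD)
    qed
    then show ?thesis using I by (auto simp: G_def poly_prod algebra_simps)
  qed
  \<comment> \<open>The coefficients \<open>\<rho> k\<close> are the residues up to the factor \<open>d k\<close>.\<close>
  have eq: "q = smult \<beta> (G I) + (\<Sum>k\<in>I. smult (\<rho> k) (G (I - {k})))" (is "_ = ?r")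
  proof (rule poly_eqI_degree_lead_coeff[where n = "card I" and A = "w ` I"])
    have small: "degree (\<Sum>k\<in>I. smult (\<rho> k) (G (I - {k}))) \<le> card I - 1"
      using I by (intro degree_sum_le order.trans[OF degree_smult_le])
        (auto simp: G_def intro!: order.trans[OF prod_deg])
    show "degree q \<le> card I" unfolding q_def by (rule prod_deg[OF I])
    show "degree ?r \<le> card I"
      using small I by (intro degree_add_le order.trans[OF degree_smult_le])
        (auto simp: G_def intro!: prod_deg)
    have "coeff (\<Sum>k\<in>I. smult (\<rho> k) (G (I - {k}))) (card I) = 0"
    proof (cases "I = {}")
      case False
      then have "card I > 0" using I by (simp add: card_gt_0_iff)
      then show ?thesis using small by (intro coeff_eq_0) auto
    qed auto
    moreover have "\<beta> * (\<Prod>i\<in>I. d i) = (\<Prod>i\<in>I. b i)"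
      using I d by (auto simp: \<beta>_def)
    ultimately show "coeff q (card I) = coeff ?r (card I)"
      using I by (simp add: q_def G_def prod_lead)
    show "card I \<le> card (w ` I)" using inj by (simp add: card_image)
    fix z assume "z \<in> w ` I"
    then obtain j where j: "j \<in> I" "z = w j" by auto
    have "poly (G I) (w j) = 0"
      using j I d[OF j(1)] by (auto simp: G_def poly_prod w_def intro!: prod_zero bexI[of _ j])
    moreover have "(\<Sum>k\<in>I. \<rho> k * poly (G (I - {k})) (w j)) = (\<Sum>k\<in>{j}. \<rho> k * poly (G (I - {k})) (w j))"
      using j I by (intro sum.mono_neutral_right) (auto simp: G_vanish)
    ultimately show "poly q z = poly ?r z"
      using j G_nonzero[OF j(1)] by (simp add: poly_sum \<rho>_def)
  qed
  have Gne: "(\<Prod>i\<in>I. c i) \<noteq> 0" using I c by auto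
  have G0: "poly (G (I - {k})) 0 = (\<Prod>i\<in>I. c i) / c k" if "k \<in> I" for k
    using that I c[OF that] by (simp add: G_def poly_prod prod.remove[of I k])
  have "(\<Prod>i\<in>I. a i) = poly ?r 0"
    using I unfolding eq[symmetric] by (simp add: q_def poly_prod)
  also have "\<dots> = \<beta> * (\<Prod>i\<in>I. c i) + (\<Sum>k\<in>I. \<rho> k * ((\<Prod>i\<in>I. c i) / c k))"
    using I by (simp add: poly_sum poly_prod G0) (simp add: G_def poly_prod)
  finally have "(\<Prod>i\<in>I. a i) / (\<Prod>i\<in>I. c i) = \<beta> + (\<Sum>k\<in>I. \<rho> k / c k)"
    using Gne by (simp add: add_divide_distrib sum_divide_distrib)
  then show ?thesis
    using I by (simp add: \<beta>_def \<rho>_def q_def G_def poly_prod mult.commute)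
qed

section \<open>Exponential bounds for factors of a product\<close>

text \<open>
  This bound is valid for every \<open>z\<close>, also when \<open>1 + z\<close> is close to zero. It therefore covers the factors
  of a numerator that may come near a zero of the reciprocal gamma function.
\<close>

lemma norm_one_plus_le_exp:
  fixes z :: complex
  shows "norm (1 + z) \<le> exp (Re z + (norm z)\<^sup>2 / 2)"
proof -
  have "(norm (1 + z))\<^sup>2 = 1 + (2 * Re z + (norm z)\<^sup>2)"
    by (simp only: cmod_power2) (simp add: power2_eq_square algebra_simps)
  also have "\<dots> \<le> exp (2 * Re z + (norm z)\<^sup>2)" by (rule exp_ge_add_one_self)
  also have "\<dots> = (exp (Re z + (norm z)\<^sup>2 / 2))\<^sup>2"
    by (simp add: exp_double[symmetric] algebra_simps)
  finally show ?thesis by (rule power2_le_imp_le) simp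
qed

text \<open>
  Since \<open>1 / (1 + z) = 1 + y\<close> with \<open>y = - z / (1 + z)\<close>, the previous bound applies to \<open>y\<close>. The lower
  bound \<open>r\<close> keeps \<open>y\<close> comparable to \<open>z\<close>, and \<open>y + z\<close> is of second order.
\<close>

lemma inverse_norm_one_plus_le_exp:
  fixes z :: complex
  assumes r: "r > 0" "norm (1 + z) \<ge> r"
  shows "inverse (norm (1 + z)) \<le> exp (- Re z + (1 / r + 1 / r\<^sup>2) * (norm z)\<^sup>2)"
proof -
  have nz: "1 + z \<noteq> 0" using r by auto
  define y where "y = - z / (1 + z)"
  have y: "inverse (1 + z) = 1 + y" using nz by (simp add: y_def divide_simps)
  have ny: "norm y \<le> norm z / r"
    using r by (auto simp: y_def norm_divide intro!: divide_left_mono mult_pos_pos)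
  have "y = - z + z * (- y)" using nz by (simp add: y_def divide_simps) (simp add: algebra_simps)
  then have "Re y = - Re z + Re (z * (- y))" by (metis plus_complex.sel(1) uminus_complex.sel(1))
  also have "Re (z * (- y)) \<le> norm z * norm y"
    using complex_Re_le_cmod[of "z * (- y)"] by (simp add: norm_mult)
  also have "\<dots> \<le> norm z * (norm z / r)" by (intro mult_left_mono ny) auto
  finally have 1: "Re y \<le> - Re z + (norm z)\<^sup>2 / r" by (simp add: power2_eq_square)
  have "(norm y)\<^sup>2 \<le> (norm z / r)\<^sup>2" by (intro power_mono ny) auto
  then have 2: "(norm y)\<^sup>2 / 2 \<le> (norm z)\<^sup>2 / r\<^sup>2"
    using zero_le_power2[of "norm z / r"] by (simp only: power_divide)
  have "inverse (norm (1 + z)) = norm (1 + y)" by (simp add: y[symmetric] norm_inverse)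
  also have "\<dots> \<le> exp (Re y + (norm y)\<^sup>2 / 2)" by (rule norm_one_plus_le_exp)
  also have "\<dots> \<le> exp (- Re z + (1 / r + 1 / r\<^sup>2) * (norm z)\<^sup>2)"
    using 1 2 by (simp add: algebra_simps)
  finally show ?thesis .
qed

text \<open>
  If \<open>\<alpha>\<close> and \<open>\<beta>\<close> are the first-order parts of \<open>x\<close> and \<open>y\<close> in a small quantity \<open>t\<close>, then a product of
  factors \<open>(1 + x) / (1 + y)\<close> is controlled by the sum of the \<open>Re (\<alpha> - \<beta>)\<close> as soon as the
  sum of the \<open>t\<^sup>2\<close> is bounded.
\<close>

lemma norm_quotient_le_exp:
  fixes x y \<alpha> \<beta> :: complex
  assumes r: "r > 0" "norm (1 + y) \<ge> r" and t: "0 \<le> t" "t \<le> 2"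
    and K: "K \<ge> 0" "norm \<alpha> \<le> K * t" "norm (x - \<alpha>) \<le> K * t\<^sup>2"
      "norm \<beta> \<le> K * t" "norm (y - \<beta>) \<le> K * t\<^sup>2"
  shows "norm ((1 + x) / (1 + y)) \<le>
    exp (Re (\<alpha> - \<beta>) + (2 * K + 9 * K\<^sup>2 * (1 / 2 + 1 / r + 1 / r\<^sup>2)) * t\<^sup>2)"
proof -
  have tt: "t\<^sup>2 \<le> 2 * t" using t by (simp add: power2_eq_square mult_right_mono)
  have sq: "(norm z)\<^sup>2 \<le> 9 * K\<^sup>2 * t\<^sup>2" if "norm \<gamma> \<le> K * t" "norm (z - \<gamma>) \<le> K * t\<^sup>2" for z \<gamma> :: complex
  proof -
    have "norm z \<le> norm \<gamma> + norm (z - \<gamma>)" by (metis norm_triangle_sub)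
    also have "\<dots> \<le> K * t + K * (2 * t)"
      using that mult_left_mono[OF tt K(1)] by linarith
    finally have "norm z \<le> 3 * K * t" by simp
    from power_mono[OF this, of 2] show ?thesis by (simp add: power_mult_distrib)
  qed
  have rx: "Re x \<le> Re \<alpha> + K * t\<^sup>2" and ry: "- Re y \<le> - Re \<beta> + K * t\<^sup>2"
    using K(3,5) abs_Re_le_cmod[of "x - \<alpha>"] abs_Re_le_cmod[of "y - \<beta>"] by auto
  define R where "R = 1 / r + 1 / r\<^sup>2"
  have R: "R \<ge> 0" using r by (simp add: R_def)
  have "norm (1 + x) \<le> exp (Re x + (norm x)\<^sup>2 / 2)" by (rule norm_one_plus_le_exp)
  moreover have "inverse (norm (1 + y)) \<le> exp (- Re y + R * (norm y)\<^sup>2)"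
    unfolding R_def using r by (rule inverse_norm_one_plus_le_exp)
  ultimately have "norm ((1 + x) / (1 + y)) \<le> exp (Re x + (norm x)\<^sup>2 / 2) * exp (- Re y + R * (norm y)\<^sup>2)"
    by (subst norm_divide, subst divide_inverse) (intro mult_mono, auto)
  also have "\<dots> = exp ((Re x + (norm x)\<^sup>2 / 2) + (- Re y + R * (norm y)\<^sup>2))"
    by (rule exp_add[symmetric])
  also have "\<dots> \<le> exp (((Re \<alpha> + K * t\<^sup>2) + (9 * K\<^sup>2 * t\<^sup>2) / 2) + ((- Re \<beta> + K * t\<^sup>2) + R * (9 * K\<^sup>2 * t\<^sup>2)))"
    unfolding exp_le_cancel_iff
    by (intro add_mono rx ry mult_left_mono divide_right_mono sq[OF K(2,3)] sq[OF K(4,5)] R) auto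
  also have "\<dots> = exp (Re (\<alpha> - \<beta>) + (2 * K + 9 * K\<^sup>2 * (1 / 2 + 1 / r + 1 / r\<^sup>2)) * t\<^sup>2)"
    by (simp add: R_def algebra_simps)
  finally show ?thesis .
qed

text \<open>
  Only finitely many of the quotients \<open>norm (z + m) / (m + 1)\<close> lie below \<open>1/2\<close>, and none of them is
  zero.
\<close>

lemma nonpos_Int_shift_norm_ge:
  fixes z :: complex
  assumes "z \<notin> \<int>\<^sub>\<le>\<^sub>0"
  obtains r where "r > 0" "\<And>m. norm (z + of_nat m) \<ge> r * real (Suc m)"
proof -
  \<comment> \<open>From \<open>m = 2 * norm z + 1\<close> on, \<open>m - norm z \<ge> (m + 1) / 2\<close>.\<close>
  define M where "M = nat \<lceil>2 * norm z + 1\<rceil>"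
  define r where "r = Min (insert (1/2) ((\<lambda>m. norm (z + of_nat m) / real (Suc m)) ` {..M}))"
  have nz: "z + of_nat m \<noteq> 0" for m using assms by (metis add_eq_0_iff2 minus_of_nat_in_nonpos_Ints)
  have "r > 0" unfolding r_def using nz by (subst Min_gr_iff) auto
  moreover have "norm (z + of_nat m) \<ge> r * real (Suc m)" for m
  proof (cases "m \<le> M")
    case True
    then have "r \<le> norm (z + of_nat m) / real (Suc m)" unfolding r_def by (intro Min_le) auto
    then show ?thesis by (simp add: field_simps)
  next
    case False
    then have m: "real m \<ge> 2 * norm z + 1" unfolding M_def by linarith
    have "r \<le> 1/2" unfolding r_def by (intro Min_le) auto
    then have "r * real (Suc m) \<le> 1/2 * real (Suc m)" by (intro mult_right_mono) auto
    also have "\<dots> \<le> real m - norm z" using m by simp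
    also have "\<dots> \<le> norm (z + of_nat m)"
      using norm_diff_ineq[of "of_nat m" z] by (simp add: add.commute)
    finally show ?thesis .
  qed
  ultimately show ?thesis using that by blast
qed

section \<open>Harmonic sums and factorials\<close>

lemma sum_atMost_remove_reflect:
  fixes f :: "nat \<Rightarrow> 'a :: comm_monoid_add"
  assumes "k \<le> n"
  shows "(\<Sum>m\<in>{..n}-{k}. f m) = (\<Sum>j<k. f (k - Suc j)) + (\<Sum>j<n-k. f (k + Suc j))"
proof -
  have "(\<Sum>m\<in>{..n}-{k}. f m) = (\<Sum>m\<in>{..<k} \<union> {k<..n}. f m)"
    using assms by (intro sum.cong) auto
  also have "\<dots> = (\<Sum>m<k. f m) + (\<Sum>m\<in>{k<..n}. f m)"
    by (intro sum.union_disjoint) auto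
  also have "(\<Sum>m<k. f m) = (\<Sum>j<k. f (k - Suc j))" by (rule sum.nat_diff_reindex[symmetric])
  also have "(\<Sum>m\<in>{k<..n}. f m) = (\<Sum>j<n-k. f (k + Suc j))"
    using assms by (intro sum.reindex_bij_witness[of _ "\<lambda>j. k + Suc j" "\<lambda>m. m - Suc k"]) auto
  finally show ?thesis .
qed

lemma harm_le_one_plus_ln:
  assumes "n \<ge> 1"
  shows "harm n \<le> 1 + ln (real n)"
proof -
  obtain m where m: "n = Suc m" using assms by (cases n) auto
  have "harm (Suc m) - ln (real (Suc m)) \<le> harm (Suc 0) - ln (real (Suc 0))"
    using decseq_harm_diff_ln by (rule decseqD) simp
  then show ?thesis by (simp add: m harm_expand)
qed

lemma sum_inverse_shift_eq_harm:
  "(\<Sum>m\<le>n. 1 / (real m + real k + 1)) = harm (n + k + 1) - (harm k :: real)"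
proof (induction n)
  case (Suc n)
  have "harm (Suc n + k + 1) = harm (n + k + 1) + 1 / (real (Suc n) + real k + 1)"
    by (simp add: harm_Suc inverse_eq_divide ac_simps)
  then show ?case using Suc by simp
qed (simp add: harm_Suc inverse_eq_divide add.commute)

lemma sum_inverse_squares_remove_le:
  fixes k n :: nat
  defines "Z \<equiv> (\<Sum>j. 1 / (real (Suc j))\<^sup>2)"
  assumes "k \<le> n"
  shows "(\<Sum>m\<in>{..n}-{k}. (1 / real (Suc m) + 1 / \<bar>real m - real k\<bar>)\<^sup>2) \<le> 6 * Z"
proof -
  have "summable (\<lambda>j. inverse (real j ^ 2))" by (rule inverse_power_summable) simp
  then have "summable (\<lambda>j. 1 / (real (Suc j))\<^sup>2)"
    by (subst (asm) summable_Suc_iff[symmetric]) (simp add: inverse_eq_divide del: of_nat_Suc)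
  then have Z: "(\<Sum>j<N. 1 / (real (Suc j))\<^sup>2) \<le> Z" for N
    unfolding Z_def by (intro sum_le_suminf) auto
  have "(\<Sum>m\<in>{..n}-{k}. (1 / real (Suc m) + 1 / \<bar>real m - real k\<bar>)\<^sup>2)
      \<le> (\<Sum>m\<in>{..n}-{k}. 2 * (1 / (real (Suc m))\<^sup>2) + 2 * (1 / (real m - real k)\<^sup>2))"
  proof (rule sum_mono)
    fix m
    have "(x + y)\<^sup>2 \<le> 2 * x\<^sup>2 + 2 * y\<^sup>2" for x y :: real
      using zero_le_power2[of "x - y"] by (simp add: power2_eq_square algebra_simps)
    from this[of "1 / real (Suc m)" "1 / \<bar>real m - real k\<bar>"]
    show "(1 / real (Suc m) + 1 / \<bar>real m - real k\<bar>)\<^sup>2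
        \<le> 2 * (1 / (real (Suc m))\<^sup>2) + 2 * (1 / (real m - real k)\<^sup>2)"
      by (simp only: power_divide power2_abs power_one)
  qed
  also have "\<dots> = 2 * (\<Sum>m\<in>{..n}-{k}. 1 / (real (Suc m))\<^sup>2) + 2 * (\<Sum>m\<in>{..n}-{k}. 1 / (real m - real k)\<^sup>2)"
    by (simp only: sum.distrib sum_distrib_left)
  also have "(\<Sum>m\<in>{..n}-{k}. 1 / (real (Suc m))\<^sup>2) \<le> (\<Sum>m<Suc n. 1 / (real (Suc m))\<^sup>2)"
    by (intro sum_mono2) auto
  also have "\<dots> \<le> Z" by (rule Z)
  also have "(\<Sum>m\<in>{..n}-{k}. 1 / (real m - real k)\<^sup>2) =
      (\<Sum>j<k. 1 / (real (Suc j))\<^sup>2) + (\<Sum>j<n-k. 1 / (real (Suc j))\<^sup>2)"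
    unfolding sum_atMost_remove_reflect[OF assms(2)]
    by (intro arg_cong2[of _ _ _ _ "(+)"] sum.cong refl) (auto simp: of_nat_diff power2_eq_iff)
  also have "\<dots> \<le> Z + Z" by (intro add_mono Z)
  finally show ?thesis by simp
qed

text \<open>
  The \<open>(k+1)\<close>-st quotient is the \<open>k\<close>-th one times \<open>(n - k) / n\<close>.
\<close>

lemma fact_quotient_asymp:
  "(\<lambda>n. fact n / (fact (n - k) * of_nat n ^ k) :: complex) \<longlonglongrightarrow> 1"
proof (induction k)
  case 0
  then show ?case by simp
next
  case (Suc k)
  have "(\<lambda>n. 1 - of_nat k * (1 / of_nat n) :: complex) \<longlonglongrightarrow> 1 - of_nat k * 0"
    by (intro tendsto_intros lim_1_over_n)
  from tendsto_mult[OF Suc this]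
  have "(\<lambda>n. fact n / (fact (n - k) * of_nat n ^ k) * (1 - of_nat k * (1 / of_nat n)) :: complex) \<longlonglongrightarrow> 1"
    by simp
  moreover have "eventually (\<lambda>n. fact n / (fact (n - k) * of_nat n ^ k) * (1 - of_nat k * (1 / of_nat n))
     = (fact n / (fact (n - Suc k) * of_nat n ^ Suc k) :: complex)) sequentially"
    using eventually_gt_at_top[of k]
  proof eventually_elim
    case (elim n)
    then obtain j where j: "n = k + Suc j" using less_iff_Suc_add by (metis add_Suc_right)
    then have n: "of_nat n = (of_nat k + of_nat (Suc j) :: complex)" by simp
    have [simp]: "of_nat n \<noteq> (0::complex)" using elim by simp
    have "1 - of_nat k * (1 / of_nat n) = ((of_nat n - of_nat k) / of_nat n :: complex)"
      using elim by (simp add: diff_divide_distrib)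
    also have "\<dots> = of_nat (Suc j) / of_nat n"
      by (simp only: n add_diff_cancel_left')
    finally have e1: "1 - of_nat k * (1 / of_nat n) = (of_nat (Suc j) / of_nat n :: complex)" .
    have e2: "fact (n - k) = (of_nat (Suc j) * fact (n - Suc k) :: complex)" using j by simp
    show ?case unfolding e1 e2 by (simp add: divide_simps del: of_nat_Suc)
  qed
  ultimately show ?case by (rule Lim_transform_eventually)
qed

lemma prod_remove_diff_eq_fact:
  assumes "k \<le> n"
  shows "(\<Prod>m\<in>{..n}-{k}. of_nat m - of_nat k :: complex) = (-1) ^ k * fact k * fact (n - k)"
  using assms
proof (induction n rule: dec_induct)
  case base
  have "(\<Prod>m\<in>{..k}-{k}. of_nat m - of_nat k :: complex) = (\<Prod>m<k. of_nat m - of_nat k)"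
    by (intro prod.cong) auto
  also have "\<dots> = (\<Prod>j<k. of_nat (k - Suc j) - of_nat k)"
    by (rule prod.nat_diff_reindex[symmetric])
  also have "\<dots> = (\<Prod>j<k. (-1) * of_nat (Suc j))"
    by (intro prod.cong) (auto simp: of_nat_diff)
  also have "\<dots> = (-1) ^ k * fact k"
    by (simp only: prod.distrib) (simp add: fact_prod_Suc atLeast0LessThan)
  finally show ?case by simp
next
  case (step n)
  have "{..Suc n} - {k} = insert (Suc n) ({..n} - {k})" using step by auto
  moreover have "of_nat (Suc n) - of_nat k = (of_nat (Suc n - k) :: complex)"
    using step by (simp only: of_nat_diff le_SucI)
  moreover have "fact (Suc n - k) = (of_nat (Suc n - k) * fact (n - k) :: complex)"
    using step by (simp add: Suc_diff_le)
  ultimately show ?case using step by (simp del: of_nat_Suc)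
qed

section \<open>A pencil of cubics\<close>

text \<open>
  The two conditions on \<open>ep\<close> and \<open>em\<close> determine the unordered pair of values at each \<open>k\<close>. All that follows
  is symmetric in the pair, so no choice of a square root enters.
\<close>

locale cubic_pencil =
  fixes x1 x2 x3 u l :: complex and ep em :: "nat \<Rightarrow> complex"
  assumes Re_pos: "Re (l + u - (x1 + x2 + x3)) > 0"
    and x1: "x1 \<notin> \<int>\<^sub>\<le>\<^sub>0" and x2: "x2 \<notin> \<int>\<^sub>\<le>\<^sub>0" and x3: "x3 \<notin> \<int>\<^sub>\<le>\<^sub>0" and l: "l \<notin> \<int>\<^sub>\<le>\<^sub>0"
    and ep: "\<And>k. ep k \<notin> \<int>\<^sub>\<le>\<^sub>0" and em: "\<And>k. em k \<notin> \<int>\<^sub>\<le>\<^sub>0"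
    and eta_sum: "\<And>k. ep k + em k = x1 + x2 + x3 + of_nat k"
    and eta_prod: "\<And>k. (l - ep k) * (l - em k) = (l - x1) * (l - x2) * (l - x3) / (l + of_nat k)"
begin

definition cubic :: "complex \<Rightarrow> complex" where
  "cubic t = (t - x1) * (t - x2) * (t - x3)"

text \<open>
  All members of the pencil have the same sum of roots \<open>x1 + x2 + x3\<close> and the same value at \<open>l\<close>. The original
  cubic is the member with \<open>w = 0\<close>.
\<close>

definition pencil :: "complex \<Rightarrow> complex \<Rightarrow> complex" where
  "pencil w t = cubic t + w * (t - l)"

text \<open>
  The parameter for which \<open>- k\<close> is a root of the member of the pencil.
\<close>

definition node :: "nat \<Rightarrow> complex" where
  "node k = cubic (- of_nat k) / (l + of_nat k)"

text \<open>
  The defect between the quadratic with roots \<open>ep k\<close>, \<open>em k\<close> and the one with roots \<open>l\<close>, \<open>c + k\<close>. It tends to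
  zero, hence for large \<open>k\<close> one of the two eta values is close to \<open>l\<close> and the other to \<open>c + k\<close>.
\<close>

definition kap :: "nat \<Rightarrow> complex" where
  "kap k = cubic l / (l + of_nat k)"

text \<open>
  The number \<open>a\<close> has positive real part, and it governs every decay rate below. The exponent \<open>s\<close> is the one for
  which \<open>n\<close> to the power \<open>s\<close> makes the finite products converge to quotients of gamma functions.
\<close>

definition a where "a = l + u - (x1 + x2 + x3)"
definition c where "c = x1 + x2 + x3 - l"
definition s where "s = 2 * (x1 + x2 + x3) - 3 * u"

text \<open>
  The contribution of the pole \<open>node k\<close> to the partial fraction expansion at \<open>w = 0\<close> of the
  normalised product of the quotients \<open>pencil w (u + m) / (- pencil w (- m))\<close> over \<open>m \<le> n\<close>.
\<close>

definition residue_term :: "nat \<Rightarrow> nat \<Rightarrow> complex" where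
  "residue_term n k = exp (s * of_real (ln (of_nat n))) *
     ((\<Prod>m\<le>n. pencil (node k) (u + of_nat m)) /
      (- cubic (- of_nat k) * (\<Prod>m\<in>{..n}-{k}. - pencil (node k) (- of_nat m))))"

lemma plus_nat_nonzero: "z \<notin> \<int>\<^sub>\<le>\<^sub>0 \<Longrightarrow> z + of_nat m \<noteq> (0::complex)"
  by (metis add_eq_0_iff2 minus_of_nat_in_nonpos_Ints)

lemma cubic_minus_nat: "- cubic (- of_nat m) = (x1 + of_nat m) * (x2 + of_nat m) * (x3 + of_nat m)"
  by (simp add: cubic_def algebra_simps)

lemma cubic_minus_nat_nonzero: "cubic (- of_nat m) \<noteq> 0"
  using cubic_minus_nat[of m] x1 x2 x3 plus_nat_nonzero by force

text \<open>
  Dividing out the known root \<open>- k\<close> leaves a quadratic, which is written as a perturbation of one with explicit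
  roots. The estimates of the terms use this form since it involves no square roots.
\<close>

lemma pencil_node_deflated:
  "pencil (node k) t = (t + of_nat k) * ((t - l) * (t - c - of_nat k) + kap k)"
proof -
  define y where "y = l + of_nat k"
  have y: "y \<noteq> 0" and k: "of_nat k = y - l" using plus_nat_nonzero[OF l] by (auto simp: y_def)
  have "y * node k = cubic (- (y - l))"
    using y unfolding node_def y_def[symmetric] k by simp
  then have "y * pencil (node k) t = y * cubic t + cubic (- (y - l)) * (t - l)"
    unfolding pencil_def distrib_left mult.assoc[symmetric] by simp
  also have "\<dots> = (t + (y - l)) * (y * ((t - l) * (t - c - (y - l))) + cubic l)"
    unfolding cubic_def c_def by (simp add: algebra_simps)
  also have "cubic l = y * kap k"
    using y unfolding kap_def y_def[symmetric] by simp
  also have "(t + (y - l)) * (y * ((t - l) * (t - c - (y - l))) + y * kap k) =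
      y * ((t + of_nat k) * ((t - l) * (t - c - of_nat k) + kap k))"
    unfolding k by (simp add: algebra_simps)
  finally show ?thesis using y by simp
qed

lemma eta_quadratic: "(t - ep k) * (t - em k) = (t - l) * (t - c - of_nat k) + kap k"
proof -
  have em: "em k = x1 + x2 + x3 + of_nat k - ep k" using eta_sum[of k] by (simp add: algebra_simps)
  have "kap k = (l - ep k) * (l - em k)" by (simp add: eta_prod kap_def cubic_def)
  then show ?thesis by (simp add: em c_def algebra_simps)
qed

lemma pencil_node: "pencil (node k) t = (t + of_nat k) * ((t - ep k) * (t - em k))"
  by (simp only: pencil_node_deflated eta_quadratic)

text \<open>
  If two parameters coincided, \<open>- m\<close> would be a root of the member of the pencil whose roots are \<open>- k\<close>,
  \<open>ep k\<close> and \<open>em k\<close>, so one of the eta values would be a non-positive integer.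
\<close>

lemma inj_node: "inj node"
proof (rule injI, rule ccontr)
  fix k m assume eq: "node k = node m" and "k \<noteq> m"
  have "pencil (node k) (- of_nat m) = 0" unfolding eq by (simp add: pencil_node)
  moreover have "(- of_nat m + of_nat k :: complex) \<noteq> 0" using \<open>k \<noteq> m\<close> by (simp add: add_eq_0_iff)
  ultimately have "ep k = - of_nat m \<or> em k = - of_nat m" by (simp add: pencil_node) fastforce
  then show False using ep[of k] em[of k] by (metis minus_of_nat_in_nonpos_Ints)
qed

section \<open>The finite expansion and the limits of its terms\<close>

text \<open>
  The quotients \<open>pencil w (u + m) / (- pencil w (- m))\<close> are linear fractional in \<open>w\<close>, so
  the general partial fraction expansion applies to their product.
\<close>

lemma finite_expansion:
  "exp (s * of_real (ln (of_nat n))) *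
     ((\<Prod>m\<le>n. cubic (u + of_nat m)) / (\<Prod>m\<le>n. - cubic (- of_nat m))) =
   exp (s * of_real (ln (of_nat n))) *
     ((\<Prod>m\<le>n. u - l + of_nat m) / (\<Prod>m\<le>n. l + of_nat m)) + (\<Sum>k\<le>n. residue_term n k)"
proof -
  have node: "- (- cubic (- of_nat i)) / (l + of_nat i) = node i" for i
    by (simp add: node_def)
  have "(\<Prod>m\<le>n. cubic (u + of_nat m)) / (\<Prod>m\<le>n. - cubic (- of_nat m)) =
      (\<Prod>m\<le>n. u - l + of_nat m) / (\<Prod>m\<le>n. l + of_nat m) +
      (\<Sum>k\<le>n. (\<Prod>m\<le>n. cubic (u + of_nat m) + (u - l + of_nat m) * node k) /
        (- cubic (- of_nat k) * (\<Prod>m\<in>{..n}-{k}. - cubic (- of_nat m) + (l + of_nat m) * node k)))"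
    by (rule partial_fractions_linear_products[of "{..n}" "\<lambda>i. l + of_nat i" "\<lambda>i. - cubic (- of_nat i)"
        "\<lambda>i. cubic (u + of_nat i)" "\<lambda>i. u - l + of_nat i", unfolded node])
      (use plus_nat_nonzero[OF l] cubic_minus_nat_nonzero inj_node in \<open>auto intro: inj_on_subset\<close>)
  moreover have "cubic (u + of_nat m) + (u - l + of_nat m) * w = pencil w (u + of_nat m)"
    "- cubic (- of_nat m) + (l + of_nat m) * w = - pencil w (- of_nat m)" for m w
    by (simp_all add: pencil_def algebra_simps)
  ultimately show ?thesis
    by (simp only: residue_term_def distrib_left sum_distrib_left)
qed

lemma prod_eq_rGamma_series:
  "(\<Prod>m\<le>n. z + of_nat m :: complex) = rGamma_series z n * (fact n * exp (z * of_real (ln (of_nat n))))"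
  by (simp add: rGamma_series_def pochhammer_Suc_prod atLeast0AtMost del: of_nat_Suc)

text \<open>
  The linear factors of the cubic turn the quotient into six of the products that define the gamma function, and
  \<open>s\<close> is chosen such that the powers of \<open>n\<close> cancel.
\<close>

lemma value_at_zero_limit:
  "(\<lambda>n. exp (s * of_real (ln (of_nat n))) *
     ((\<Prod>m\<le>n. cubic (u + of_nat m)) / (\<Prod>m\<le>n. - cubic (- of_nat m))))
   \<longlonglongrightarrow> Gamma x1 * Gamma x2 * Gamma x3 * rGamma (u - x1) * rGamma (u - x2) * rGamma (u - x3)"
proof -
  have "exp (s * of_real (ln (of_nat n))) *
     ((\<Prod>m\<le>n. cubic (u + of_nat m)) / (\<Prod>m\<le>n. - cubic (- of_nat m))) =
     (rGamma_series (u - x1) n * rGamma_series (u - x2) n * rGamma_series (u - x3) n) /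
     (rGamma_series x1 n * rGamma_series x2 n * rGamma_series x3 n)" for n
  proof -
    define L :: complex where "L = of_real (ln (of_nat n))"
    have 1: "(\<Prod>m\<le>n. cubic (u + of_nat m)) =
        (\<Prod>m\<le>n. u - x1 + of_nat m) * (\<Prod>m\<le>n. u - x2 + of_nat m) * (\<Prod>m\<le>n. u - x3 + of_nat m)"
      by (simp add: cubic_def prod.distrib[symmetric] algebra_simps)
    have 2: "(\<Prod>m\<le>n. - cubic (- of_nat m)) =
        (\<Prod>m\<le>n. x1 + of_nat m) * (\<Prod>m\<le>n. x2 + of_nat m) * (\<Prod>m\<le>n. x3 + of_nat m)"
      by (simp add: cubic_minus_nat prod.distrib)
    have "exp (s * L) * exp ((u - x1) * L) * exp ((u - x2) * L) * exp ((u - x3) * L)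
        = exp (x1 * L) * exp (x2 * L) * exp (x3 * L)"
      by (simp add: exp_add[symmetric] s_def algebra_simps)
    then show ?thesis unfolding 1 2 prod_eq_rGamma_series L_def[symmetric]
      by (simp add: divide_simps mult.assoc)
  qed
  moreover have "(\<lambda>n. (rGamma_series (u - x1) n * rGamma_series (u - x2) n * rGamma_series (u - x3) n) /
     (rGamma_series x1 n * rGamma_series x2 n * rGamma_series x3 n)) \<longlonglongrightarrow>
     (rGamma (u - x1) * rGamma (u - x2) * rGamma (u - x3)) / (rGamma x1 * rGamma x2 * rGamma x3)"
    using x1 x2 x3 by (intro tendsto_intros) (auto simp: rGamma_eq_zero_iff)
  ultimately show ?thesis by (simp add: Gamma_def field_simps)
qed

text \<open>
  Here the powers of \<open>n\<close> leave the exponent \<open>- 2 * a\<close>. This is where the hypothesis on the real part removes the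
  boundary term.
\<close>

lemma value_at_infinity_limit:
  "(\<lambda>n. exp (s * of_real (ln (of_nat n))) *
     ((\<Prod>m\<le>n. u - l + of_nat m) / (\<Prod>m\<le>n. l + of_nat m))) \<longlonglongrightarrow> 0"
proof -
  have "exp (s * of_real (ln (of_nat n))) *
     ((\<Prod>m\<le>n. u - l + of_nat m) / (\<Prod>m\<le>n. l + of_nat m)) =
     rGamma_series (u - l) n / rGamma_series l n * exp (- 2 * a * of_real (ln (of_nat n)))" for n
  proof -
    define L :: complex where "L = of_real (ln (of_nat n))"
    have "exp (s * L) * exp ((u - l) * L) = exp (- 2 * a * L) * exp (l * L)"
      by (simp add: exp_add[symmetric] s_def a_def algebra_simps)
    then show ?thesis unfolding prod_eq_rGamma_series L_def[symmetric]
      by (simp add: divide_simps)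
  qed
  moreover have "(\<lambda>n. exp (- 2 * a * of_real (ln (of_nat n)))) \<longlonglongrightarrow> 0"
  proof (rule tendsto_norm_zero_cancel)
    have a: "Re a > 0" using Re_pos by (simp add: a_def)
    have "filterlim (\<lambda>n. (2 * Re a) * ln (real n)) at_top sequentially"
      using a by (intro filterlim_tendsto_pos_mult_at_top[OF tendsto_const]
          filterlim_compose[OF ln_at_top filterlim_real_sequentially]) auto
    then have "filterlim (\<lambda>n. - ((2 * Re a) * ln (real n))) at_bot sequentially"
      by (simp add: filterlim_uminus_at_top)
    then have "(\<lambda>n. exp (- ((2 * Re a) * ln (real n)))) \<longlonglongrightarrow> 0"
      by (rule filterlim_compose[OF exp_at_bot])
    then show "(\<lambda>n. norm (exp (- 2 * a * of_real (ln (of_nat n))))) \<longlonglongrightarrow> 0" by simp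
  qed
  then have "(\<lambda>n. rGamma_series (u - l) n / rGamma_series l n * exp (- 2 * a * of_real (ln (of_nat n))))
     \<longlonglongrightarrow> rGamma (u - l) / rGamma l * 0"
    using l by (intro tendsto_intros) (auto simp: rGamma_eq_zero_iff)
  ultimately show ?thesis by simp
qed

text \<open>
  The numerator on the left arises when the products over \<open>m \<noteq> k\<close> of \<open>ep k + m\<close> and \<open>em k + m\<close> in
  the residue term of index \<open>k\<close> are completed by their factors at \<open>m = k\<close>. The right side is the logarithmic
  derivative of \<open>cubic t / (t - l)\<close> at \<open>t = - k\<close>, up to sign.
\<close>

lemma eta_shift_product:
  "(ep k + of_nat k) * (em k + of_nat k) / (- cubic (- of_nat k)) =
     1 / (x1 + of_nat k) + 1 / (x2 + of_nat k) + 1 / (x3 + of_nat k) - 1 / (l + of_nat k)"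
proof -
  define y1 y2 y3 y where "y1 = x1 + of_nat k" "y2 = x2 + of_nat k" "y3 = x3 + of_nat k" "y = l + of_nat k"
  note ys = this
  have nz: "y1 \<noteq> 0" "y2 \<noteq> 0" "y3 \<noteq> 0" "y \<noteq> 0"
    using plus_nat_nonzero x1 x2 x3 l by (auto simp: ys)
  have kap: "kap k = (y - y1) * (y - y2) * (y - y3) / y"
    by (simp add: kap_def cubic_def ys)
  have "(ep k + of_nat k) * (em k + of_nat k) = (- of_nat k - ep k) * (- of_nat k - em k)"
    by (simp add: algebra_simps)
  also have "\<dots> = y * (y1 + y2 + y3 - y) + kap k"
    unfolding eta_quadratic by (simp add: ys c_def algebra_simps)
  finally show ?thesis
    unfolding kap cubic_minus_nat ys[symmetric] using nz
    by (simp add: divide_simps) (simp add: algebra_simps)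
qed

text \<open>
  At the parameter \<open>node k\<close> the cubic has the roots \<open>- k\<close>, \<open>ep k\<close> and \<open>em k\<close>, so all products are Pochhammer
  symbols. The product belonging to the root \<open>- k\<close> lacks its vanishing factor and gives
  \<open>(-1) ^ k * fact k * fact (n - k)\<close>.
\<close>

lemma term_limit:
  "(\<lambda>n. residue_term n k) \<longlonglongrightarrow> (-1) ^ k / fact k *
     (Gamma (ep k) * Gamma (em k) * rGamma (u + of_nat k) * rGamma (u - ep k) * rGamma (u - em k)) *
     (1 / (x1 + of_nat k) + 1 / (x2 + of_nat k) + 1 / (x3 + of_nat k) - 1 / (l + of_nat k))"
proof -
  define F where "F = (ep k + of_nat k) * (em k + of_nat k) / (- cubic (- of_nat k))"
  have epk: "ep k + of_nat k \<noteq> 0" and emk: "em k + of_nat k \<noteq> 0"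
    using plus_nat_nonzero ep em by auto
  have "(\<lambda>n. F * ((-1) ^ k / fact k) *
      (rGamma_series (u + of_nat k) n * rGamma_series (u - ep k) n * rGamma_series (u - em k) n /
       (rGamma_series (ep k) n * rGamma_series (em k) n)) *
      (fact n / (fact (n - k) * of_nat n ^ k))) \<longlonglongrightarrow> F * ((-1) ^ k / fact k) *
      (rGamma (u + of_nat k) * rGamma (u - ep k) * rGamma (u - em k) /
       (rGamma (ep k) * rGamma (em k))) * 1"
    using ep em by (intro tendsto_intros fact_quotient_asymp) (auto simp: rGamma_eq_zero_iff)
  moreover have "eventually (\<lambda>n. F * ((-1) ^ k / fact k) *
      (rGamma_series (u + of_nat k) n * rGamma_series (u - ep k) n * rGamma_series (u - em k) n /
       (rGamma_series (ep k) n * rGamma_series (em k) n)) *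
      (fact n / (fact (n - k) * of_nat n ^ k)) = residue_term n k) sequentially"
    using eventually_ge_at_top[of "Suc k"]
  proof eventually_elim
    case (elim n)
    define L :: complex where "L = of_real (ln (of_nat n))"
    have num: "(\<Prod>m\<le>n. pencil (node k) (u + of_nat m)) = (\<Prod>m\<le>n. u + of_nat k + of_nat m) *
        (\<Prod>m\<le>n. u - ep k + of_nat m) * (\<Prod>m\<le>n. u - em k + of_nat m)"
      by (simp add: pencil_node prod.distrib[symmetric] algebra_simps)
    have "(\<Prod>m\<in>{..n}-{k}. - pencil (node k) (- of_nat m)) =
        (\<Prod>m\<in>{..n}-{k}. of_nat m - of_nat k) *
        (\<Prod>m\<in>{..n}-{k}. ep k + of_nat m) * (\<Prod>m\<in>{..n}-{k}. em k + of_nat m)"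
      by (simp add: pencil_node prod.distrib[symmetric] algebra_simps)
    also have "(\<Prod>m\<in>{..n}-{k}. ep k + of_nat m) = (\<Prod>m\<le>n. ep k + of_nat m) / (ep k + of_nat k)"
      using epk elim by (subst prod.remove[of "{..n}" k]) auto
    also have "(\<Prod>m\<in>{..n}-{k}. em k + of_nat m) = (\<Prod>m\<le>n. em k + of_nat m) / (em k + of_nat k)"
      using emk elim by (subst prod.remove[of "{..n}" k]) auto
    also have "(\<Prod>m\<in>{..n}-{k}. of_nat m - of_nat k :: complex) = (-1) ^ k * fact k * fact (n - k)"
      using elim by (intro prod_remove_diff_eq_fact) auto
    finally have den: "(\<Prod>m\<in>{..n}-{k}. - pencil (node k) (- of_nat m)) =
        (-1) ^ k * fact k * fact (n - k) * ((\<Prod>m\<le>n. ep k + of_nat m) / (ep k + of_nat k)) *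
        ((\<Prod>m\<le>n. em k + of_nat m) / (em k + of_nat k))" .
    have pow: "of_nat n ^ k = exp (of_nat k * L)"
      using elim by (simp add: L_def exp_of_nat_mult exp_of_real)
    have es: "em k = x1 + x2 + x3 + of_nat k - ep k" using eta_sum[of k] by (simp add: algebra_simps)
    have exps: "exp (s * L) * exp ((u + of_nat k) * L) * exp ((u - ep k) * L) * exp ((u - em k) * L)
        / (exp (ep k * L) * exp (em k * L)) = inverse (of_nat n ^ k)"
      unfolding pow by (simp add: exp_add[symmetric] exp_diff[symmetric] exp_minus[symmetric] s_def es algebra_simps)
    have sgn: "inverse ((-1 :: complex) ^ k) = (-1) ^ k" by (simp add: power_inverse[symmetric])
    have "residue_term n k = F * (inverse ((-1) ^ k) / fact k) *
      (rGamma_series (u + of_nat k) n * rGamma_series (u - ep k) n * rGamma_series (u - em k) n /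
       (rGamma_series (ep k) n * rGamma_series (em k) n)) * (fact n / fact (n - k)) *
      (exp (s * L) * exp ((u + of_nat k) * L) * exp ((u - ep k) * L) * exp ((u - em k) * L)
        / (exp (ep k * L) * exp (em k * L)))"
      unfolding residue_term_def num den prod_eq_rGamma_series L_def[symmetric] F_def
      by (simp add: divide_inverse ac_simps) (simp add: field_simps)
    then show ?case unfolding exps sgn by (simp add: divide_inverse ac_simps)
  qed
  ultimately have "(\<lambda>n. residue_term n k) \<longlonglongrightarrow> F * ((-1) ^ k / fact k) *
      (rGamma (u + of_nat k) * rGamma (u - ep k) * rGamma (u - em k) /
       (rGamma (ep k) * rGamma (em k))) * 1"
    by (rule Lim_transform_eventually)
  then show ?thesis unfolding F_def eta_shift_product by (simp add: Gamma_def field_simps)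
qed

section \<open>A summable bound for the terms\<close>

lemma kap_tendsto_0: "kap \<longlonglongrightarrow> 0"
  unfolding kap_def
  by (intro tendsto_divide_0[OF tendsto_const] tendsto_add_filterlim_at_infinity[OF tendsto_const]
      tendsto_of_nat)

text \<open>
  Numerator and denominator are both divided by \<open>(m + 1) * (m + k + 1) * (m - k)\<close>, that is, multiplied by
  \<open>A * B * E\<close> with the reciprocals \<open>A\<close>, \<open>B\<close>, \<open>E\<close>. Both become \<open>1\<close> plus a linear form in \<open>A\<close>, \<open>B\<close>, \<open>E\<close> plus
  terms of second order, uniformly in \<open>k\<close> and \<open>m\<close>; the bound on \<open>kap k\<close> keeps the denominator away from zero.
\<close>

lemma factor_quotient_bound:
  obtains k0 C where "k0 \<ge> 1" "C \<ge> 0"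
    "\<And>k m. k \<ge> k0 \<Longrightarrow> m \<noteq> k \<Longrightarrow>
      norm (pencil (node k) (u + of_nat m) / (- pencil (node k) (- of_nat m))) \<le>
      exp (Re a * (1 / (real m + real k + 1) + 1 / (real m - real k)) + Re (u - 2 * l) * (1 / real (Suc m))
        + C * (1 / real (Suc m) + 1 / \<bar>real m - real k\<bar>)\<^sup>2)"
proof -
  obtain r0 where r0: "r0 > 0" "\<And>m. norm (l + of_nat m) \<ge> r0 * real (Suc m)"
    using nonpos_Int_shift_norm_ge[OF l] by blast
  have "eventually (\<lambda>k. norm (kap k) < min 1 (r0 / 4)) sequentially"
    using r0 by (intro order_tendstoD(2)[OF tendsto_norm_zero[OF kap_tendsto_0]]) auto
  then obtain k1 where k1: "\<And>k. k \<ge> k1 \<Longrightarrow> norm (kap k) < min 1 (r0 / 4)"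
    by (auto simp: eventually_sequentially)
  \<comment> \<open>The bound on \<open>c\<close> gives \<open>norm (c + k + m) \<ge> (m + k + 1) / 2\<close> for all \<open>m\<close>.\<close>
  define k0 where "k0 = max 1 (max k1 (nat \<lceil>2 * norm c + 1\<rceil>))"
  define p q where "p = u - 1" and "q = u - l - 1"
  define p' q' where "p' = c - 1" and "q' = l - 1"
  define S where "S = 1 + norm p + norm q + norm a + norm q * norm a + norm p' + norm q' + norm q' * norm p'"
  define K where "K = S + 3 * S\<^sup>2"
  define r where "r = r0 / 4"
  define C where "C = 2 * K + 9 * K\<^sup>2 * (1 / 2 + 1 / r + 1 / r\<^sup>2)"
  have S: "S \<ge> 1" "norm p \<le> S" "norm p + norm q + norm a \<le> S" "norm q * norm a + 1 \<le> S"
      "norm p' + norm q' \<le> S" "norm q' * norm p' + 1 \<le> S"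
    by (simp_all add: S_def)
  have K: "K \<ge> 0" "S \<le> K" using S by (simp_all add: K_def)
  have r: "r > 0" using r0 by (simp add: r_def)
  show ?thesis
  proof (rule that[of k0 C])
    show "k0 \<ge> 1" by (simp add: k0_def)
    show "C \<ge> 0" unfolding C_def using K r by (intro add_nonneg_nonneg mult_nonneg_nonneg) auto
    fix k m :: nat assume k: "k \<ge> k0" and mk: "m \<noteq> k"
    have kap: "norm (kap k) \<le> 1" "norm (kap k) \<le> r0 / 4"
      using k1[of k] k by (auto simp: k0_def)
    have kc: "real k \<ge> 2 * norm c + 1" using k unfolding k0_def by linarith
    define A B E :: complex where "A = of_real (1 / real (Suc m))"
      and "B = of_real (1 / (real m + real k + 1))" and "E = of_real (1 / (real m - real k))"
    define t where "t = 1 / real (Suc m) + 1 / \<bar>real m - real k\<bar>"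
    have mk1: "\<bar>real m - real k\<bar> \<ge> 1" using mk by linarith
    have nA: "norm A = 1 / real (Suc m)" and nB: "norm B = 1 / (real m + real k + 1)"
      and nE: "norm E = 1 / \<bar>real m - real k\<bar>"
      by (simp_all add: A_def B_def E_def norm_divide del: of_nat_Suc of_real_divide)
    have A1: "norm A \<le> 1" "norm A \<le> t" and B1: "norm B \<le> 1" and E1: "norm E \<le> 1" "norm E \<le> t"
      using mk1 unfolding nA nB nE t_def by auto
    have "norm B \<le> norm A" unfolding nA nB by (intro divide_left_mono) auto
    then have B2: "norm B \<le> t" using A1 by simp
    have "t = norm A + norm E" by (simp only: t_def nA nE)
    then have t: "0 \<le> t" "t \<le> 2" using A1 E1 by auto
    have mA: "of_nat m * A = 1 - A"
    proof -
      have "(of_nat m + 1) * A = 1"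
        using of_nat_neq_0[of m, where 'a = complex] by (simp add: A_def add.commute)
      then show ?thesis by (simp add: algebra_simps)
    qed
    have mB: "(of_nat m + of_nat k) * B = 1 - B"
    proof -
      have "(of_nat m + of_nat k + 1) * B = 1"
        using of_nat_neq_0[of "m + k", where 'a = complex] by (simp add: B_def add_ac)
      then show ?thesis by (simp add: algebra_simps)
    qed
    have mE: "of_nat m * E = 1 + of_nat k * E"
    proof -
      have "(of_nat m - of_nat k) * E = 1" using mk by (simp add: E_def)
      then show ?thesis by (simp add: algebra_simps)
    qed
    have nz: "A \<noteq> 0" "B \<noteq> 0" "E \<noteq> 0" using mk1 nA nB nE by auto
    define x y where "x = pencil (node k) (u + of_nat m) * (A * B * E) - 1"
      and "y = - pencil (node k) (- of_nat m) * (A * B * E) - 1"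
    define \<alpha> \<beta> where "\<alpha> = p * B + q * A + a * E" and "\<beta> = q' * A + p' * B"
    have uB: "(u + of_nat m + of_nat k) * B = 1 + p * B"
      using mB by (simp add: p_def algebra_simps)
    have uA: "(u + of_nat m - l) * A = 1 + q * A"
      using mA by (simp add: q_def algebra_simps)
    have uE: "(u + of_nat m - c - of_nat k) * E = 1 + a * E"
      using mE by (simp add: a_def c_def algebra_simps)
    have lA: "(l + of_nat m) * A = 1 + q' * A"
      using mA by (simp add: q'_def algebra_simps)
    have cB: "(c + of_nat k + of_nat m) * B = 1 + p' * B"
      using mB by (simp add: p'_def algebra_simps)
    have "1 + x = ((u + of_nat m + of_nat k) * B) *
        (((u + of_nat m - l) * A) * ((u + of_nat m - c - of_nat k) * E) + kap k * (A * E))"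
      unfolding x_def pencil_node_deflated by (simp add: algebra_simps)
    then have x: "1 + x = (1 + p * B) * ((1 + q * A) * (1 + a * E) + kap k * (A * E))"
      unfolding uA uB uE .
    have "1 + y = ((of_nat m - of_nat k) * E) *
        (((l + of_nat m) * A) * ((c + of_nat k + of_nat m) * B) + kap k * (A * B))"
      unfolding y_def pencil_node_deflated by (simp add: algebra_simps)
    moreover have "(of_nat m - of_nat k) * E = 1" using mE by (simp add: algebra_simps)
    ultimately have y': "1 + y = ((l + of_nat m) * A) * ((c + of_nat k + of_nat m) * B) + kap k * (A * B)"
      by simp
    then have y: "1 + y = (1 + q' * A) * (1 + p' * B) + kap k * (A * B)"
      unfolding lA cB .
    have small: "norm (z * X) \<le> norm z * t" if "norm X \<le> t" for z X :: complex
      unfolding norm_mult using that by (intro mult_left_mono) auto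
    have small2: "norm (z * (X * Y)) \<le> N * t\<^sup>2" if "norm z \<le> N" "norm X \<le> t" "norm Y \<le> t"
      for z X Y :: complex and N
      unfolding norm_mult power2_eq_square using that order.trans[OF norm_ge_zero that(1)] t
      by (intro mult_mono mult_nonneg_nonneg) auto
    have coef: "norm (q * a + kap k) \<le> S"
      using norm_triangle_ineq[of "q * a" "kap k"] kap S by (simp add: norm_mult)
    have \<alpha>: "norm \<alpha> \<le> S * t"
    proof -
      have "norm \<alpha> \<le> norm (p * B) + norm (q * A) + norm (a * E)"
        unfolding \<alpha>_def by (intro norm_triangle_le add_mono) auto
      also have "\<dots> \<le> norm p * t + norm q * t + norm a * t"
        by (intro add_mono small A1 B2 E1)
      also have "\<dots> = (norm p + norm q + norm a) * t" by (simp add: algebra_simps)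
      also have "\<dots> \<le> S * t" using S t by (intro mult_right_mono)
      finally show ?thesis .
    qed
    have \<beta>: "norm \<beta> \<le> S * t"
    proof -
      have "norm \<beta> \<le> norm (q' * A) + norm (p' * B)"
        unfolding \<beta>_def by (rule norm_triangle_ineq)
      also have "\<dots> \<le> norm q' * t + norm p' * t"
        by (intro add_mono small A1 B2)
      also have "\<dots> = (norm p' + norm q') * t" by (simp add: algebra_simps)
      also have "\<dots> \<le> S * t" using S t by (intro mult_right_mono)
      finally show ?thesis .
    qed
    have x\<alpha>: "norm (x - \<alpha>) \<le> K * t\<^sup>2"
    proof -
      have "x = (1 + p * B) * ((1 + q * A) * (1 + a * E) + kap k * (A * E)) - 1"
        using x by (simp add: algebra_simps)
      then have "x - \<alpha> = (q * a + kap k) * (A * E) + (p * q) * (B * A) + (p * a) * (B * E)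
          + (p * (q * a + kap k) * E) * (B * A)"
        by (simp add: \<alpha>_def algebra_simps)
      also have "norm \<dots> \<le> S * t\<^sup>2 + (S * S) * t\<^sup>2 + (S * S) * t\<^sup>2 + (S * S * 1) * t\<^sup>2"
      proof (intro norm_triangle_le add_mono small2 coef A1 B2 E1)
        have "norm q \<le> S" "norm a \<le> S" using S(3) norm_ge_zero[of p] norm_ge_zero[of q] norm_ge_zero[of a]
          by linarith+
        moreover have pz: "norm (p * z) \<le> S * S" if "norm z \<le> S" for z
          unfolding norm_mult using S that by (intro mult_mono) auto
        ultimately show "norm (p * q) \<le> S * S" "norm (p * a) \<le> S * S" by blast+
        show "norm (p * (q * a + kap k) * E) \<le> S * S * 1"
          unfolding norm_mult[of _ E] using pz[OF coef] E1 S by (intro mult_mono) auto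
      qed (use kap S in \<open>simp add: norm_mult\<close>)
      also have "\<dots> = K * t\<^sup>2" by (simp add: K_def power2_eq_square algebra_simps)
      finally show ?thesis .
    qed
    have y\<beta>: "norm (y - \<beta>) \<le> K * t\<^sup>2"
    proof -
      have "y = (1 + q' * A) * (1 + p' * B) + kap k * (A * B) - 1"
        using y by (simp add: algebra_simps)
      then have "y - \<beta> = (q' * p' + kap k) * (A * B)" by (simp add: \<beta>_def algebra_simps)
      also have "norm \<dots> \<le> S * t\<^sup>2"
        using norm_triangle_ineq[of "q' * p'" "kap k"] kap S
        by (intro small2 A1 B2) (simp add: norm_mult)
      also have "\<dots> \<le> K * t\<^sup>2" using K by (intro mult_right_mono) auto
      finally show ?thesis .
    qed
    have ylow: "norm (1 + y) \<ge> r"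
    proof -
      have "norm ((l + of_nat m) * A) \<ge> r0"
        using r0(2)[of m] unfolding norm_mult nA by (simp add: pos_le_divide_eq)
      moreover have "norm ((c + of_nat k + of_nat m) * B) \<ge> 1 / 2"
      proof -
        have eq: "c + of_nat k + of_nat m = of_nat (k + m) + c" by simp
        have "(real m + real k + 1) / 2 \<le> real (k + m) - norm c" using kc by (simp add: field_simps)
        also have "\<dots> \<le> norm (c + of_nat k + of_nat m)"
          unfolding eq using norm_diff_ineq[of "of_nat (k + m) :: complex" c] unfolding norm_of_nat .
        finally show ?thesis unfolding norm_mult nB by (simp add: pos_le_divide_eq)
      qed
      ultimately have "norm ((l + of_nat m) * A) * norm ((c + of_nat k + of_nat m) * B) \<ge> r0 * (1 / 2)"
        using r0 by (intro mult_mono) auto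
      moreover have "norm (kap k * (A * B)) \<le> (r0 / 4) * (1 * 1)"
        unfolding norm_mult using kap A1 B1 r0 by (intro mult_mono mult_nonneg_nonneg) auto
      ultimately show ?thesis
        unfolding y' r_def
        using norm_diff_ineq[of "((l + of_nat m) * A) * ((c + of_nat k + of_nat m) * B)" "kap k * (A * B)"]
        by (simp add: norm_mult)
    qed
    have "pencil (node k) (u + of_nat m) / (- pencil (node k) (- of_nat m)) = (1 + x) / (1 + y)"
      using nz by (simp add: x_def y_def)
    moreover have "norm ((1 + x) / (1 + y)) \<le> exp (Re (\<alpha> - \<beta>) + C * t\<^sup>2)"
      unfolding C_def using r ylow t K(1) order.trans[OF \<alpha>] x\<alpha> order.trans[OF \<beta>] y\<beta> K(2)
      by (intro norm_quotient_le_exp) (auto intro: mult_right_mono)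
    moreover have "\<alpha> - \<beta> = a * (B + E) + (u - 2 * l) * A"
      by (simp add: \<alpha>_def \<beta>_def p_def q_def p'_def q'_def a_def c_def algebra_simps)
    then have "Re (\<alpha> - \<beta>) = Re a * (1 / (real m + real k + 1) + 1 / (real m - real k)) +
        Re (u - 2 * l) * (1 / real (Suc m))"
      unfolding A_def B_def E_def of_real_add[symmetric] by (simp del: of_real_divide of_real_add of_nat_Suc)
    ultimately show "norm (pencil (node k) (u + of_nat m) / (- pencil (node k) (- of_nat m))) \<le>
      exp (Re a * (1 / (real m + real k + 1) + 1 / (real m - real k)) + Re (u - 2 * l) * (1 / real (Suc m))
        + C * (1 / real (Suc m) + 1 / \<bar>real m - real k\<bar>)\<^sup>2)"
      by (simp only: t_def)
  qed
qed

text \<open>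
  With harmonic numbers replaced by logarithms, each of the two sums with coefficient \<open>\<alpha>\<close> is at most
  \<open>ln n - ln k\<close>, and the sum with coefficient \<open>v\<close> is \<open>ln n\<close>, up to bounded errors. The former bounds are one-sided,
  whence the condition on the sign of \<open>\<alpha>\<close>.
\<close>

lemma exponent_sum_bound:
  fixes v \<alpha> :: real
  assumes "\<alpha> \<ge> 0" "1 \<le> k" "k \<le> n"
  shows "(\<Sum>m\<in>{..n}-{k}. \<alpha> * (1 / (real m + real k + 1) + 1 / (real m - real k)) + v * (1 / real (Suc m)))
    \<le> (2 * \<alpha> + v) * ln (real n) - 2 * \<alpha> * ln (real k) + 4 * \<alpha> + 3 * \<bar>v\<bar>"
proof -
  have split: "(\<Sum>m\<in>{..n}-{k}. f m) = (\<Sum>m\<le>n. f m) - f k" for f :: "nat \<Rightarrow> real"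
    using assms by (subst sum_diff1) auto
  have B: "(\<Sum>m\<in>{..n}-{k}. 1 / (real m + real k + 1)) \<le> harm (n + k + 1) - harm k"
    unfolding split sum_inverse_shift_eq_harm by simp
  have E: "(\<Sum>m\<in>{..n}-{k}. 1 / (real m - real k)) = harm (n - k) - harm k"
  proof -
    have "(\<Sum>m\<in>{..n}-{k}. 1 / (real m - real k)) =
        (\<Sum>j<k. - inverse (real (Suc j))) + (\<Sum>j<n-k. inverse (real (Suc j)))"
      unfolding sum_atMost_remove_reflect[OF assms(3)]
      by (intro arg_cong2[of _ _ _ _ "(+)"] sum.cong refl) (auto simp: of_nat_diff divide_simps)
    then show ?thesis by (simp add: harm_altdef sum_negf)
  qed
  have "(\<Sum>m\<le>n. 1 / real (Suc m)) = harm (n + 1)"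
    using sum_inverse_shift_eq_harm[where k = 0 and n = n] by (simp add: harm_expand add.commute)
  then have A: "(\<Sum>m\<in>{..n}-{k}. 1 / real (Suc m)) = harm (n + 1) - 1 / real (Suc k)"
    unfolding split by simp
  have ln3: "ln (3::real) \<le> 2" using ln_le_minus_one[of 3] by simp
  have ln_le: "ln (real j) \<le> 2 + ln (real n)" if "1 \<le> j" "j \<le> 3 * n" for j
  proof -
    have "ln (real j) \<le> ln (3 * real n)" using that by (subst ln_le_cancel_iff) auto
    also have "\<dots> = ln 3 + ln (real n)" using assms by (subst ln_mult) auto
    finally show ?thesis using ln3 by simp
  qed
  have h1: "harm (n + k + 1) \<le> 3 + ln (real n)"
    using harm_le_one_plus_ln[of "n + k + 1"] ln_le[of "n + k + 1"] assms by simp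
  have h2: "harm (n - k) \<le> 1 + ln (real n)"
    using harm_mono[of "n - k" n, where 'a = real] harm_le_one_plus_ln[of n] assms by simp
  have h3: "harm k \<ge> ln (real k)"
    using ln_le_harm[of k] ln_le_cancel_iff[of "real k" "real k + 1"] assms by linarith
  have h4: "\<bar>harm (n + 1) - 1 / real (Suc k) - ln (real n)\<bar> \<le> 3"
  proof -
    have "harm (n + 1) \<le> 3 + ln (real n)"
      using harm_le_one_plus_ln[of "n + 1"] ln_le[of "n + 1"] assms by simp
    moreover have "harm (n + 1) \<ge> ln (real n)"
    proof -
      have "ln (real n) \<le> ln (real (n + 1) + 1)" using assms by (subst ln_le_cancel_iff) auto
      then show ?thesis using ln_le_harm[of "n + 1"] by simp
    qed
    moreover have "1 / real (Suc k) \<le> 1" "1 / real (Suc k) \<ge> 0" by auto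
    ultimately show ?thesis by linarith
  qed
  have "v * (harm (n + 1) - 1 / real (Suc k) - ln (real n)) \<le> \<bar>v\<bar> * 3"
    by (rule order.trans[OF abs_ge_self]) (unfold abs_mult, intro mult_left_mono h4 abs_ge_zero)
  then have v: "v * (harm (n + 1) - 1 / real (Suc k)) \<le> v * ln (real n) + 3 * \<bar>v\<bar>"
    by (simp add: right_diff_distrib)
  have "(\<Sum>m\<in>{..n}-{k}. \<alpha> * (1 / (real m + real k + 1) + 1 / (real m - real k)) + v * (1 / real (Suc m)))
    = \<alpha> * ((\<Sum>m\<in>{..n}-{k}. 1 / (real m + real k + 1)) + (\<Sum>m\<in>{..n}-{k}. 1 / (real m - real k)))
      + v * (\<Sum>m\<in>{..n}-{k}. 1 / real (Suc m))"
    by (simp only: sum.distrib sum_distrib_left distrib_left)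
  also have "\<dots> \<le> \<alpha> * ((3 + ln (real n) - ln (real k)) + (1 + ln (real n) - ln (real k)))
      + (v * ln (real n) + 3 * \<bar>v\<bar>)"
    unfolding E A using B h1 h2 h3 assms(1) v by (intro add_mono mult_left_mono) linarith+
  also have "\<dots> = (2 * \<alpha> + v) * ln (real n) - 2 * \<alpha> * ln (real k) + 4 * \<alpha> + 3 * \<bar>v\<bar>"
    by (simp add: algebra_simps)
  finally show ?thesis .
qed

text \<open>
  The factor with \<open>m = k\<close> grows quadratically, against the cubic growth of \<open>cubic (- k)\<close>.
\<close>

lemma diagonal_factor_bound:
  obtains k0 C where "k0 \<ge> 1" "C \<ge> 0"
    "\<And>k. k \<ge> k0 \<Longrightarrow> norm (pencil (node k) (u + of_nat k) / (- cubic (- of_nat k))) \<le> C / real k"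
proof -
  have "eventually (\<lambda>k. norm (kap k) < 1) sequentially"
    using kap_tendsto_0 by (auto simp: tendsto_iff dist_norm)
  then obtain k1 where k1: "\<And>k. k \<ge> k1 \<Longrightarrow> norm (kap k) < 1"
    by (auto simp: eventually_sequentially)
  define R where "R = norm x1 + norm x2 + norm x3"
  define k0 where "k0 = max 1 (max k1 (nat \<lceil>2 * R\<rceil>))"
  define C where "C = 8 * ((norm u + 2) * ((norm (u - l) + 1) * norm a + 1))"
  show ?thesis
  proof (rule that[of k0 C])
    show "k0 \<ge> 1" by (simp add: k0_def)
    show "C \<ge> 0" by (simp add: C_def)
    fix k assume k: "k \<ge> k0"
    have kap: "norm (kap k) \<le> 1" using k k1[of k] by (simp add: k0_def)
    have k': "real k \<ge> 1" "real k \<ge> 2 * R"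
      using k unfolding k0_def by linarith+
    have le: "norm z + j \<le> (norm z + j) * real k" if "j \<ge> 0" for z :: complex and j :: real
      using mult_left_mono[OF k'(1), of "norm z + j"] that by simp
    have x: "norm (z + of_nat k) \<ge> real k / 2" if "norm z \<le> R" for z :: complex
      using norm_diff_ineq[of "of_nat k" z] that k' by (simp add: add.commute)
    have "norm (- cubic (- of_nat k)) \<ge> (real k / 2) * (real k / 2) * (real k / 2)"
      unfolding cubic_minus_nat norm_mult
      by (intro mult_mono x mult_nonneg_nonneg) (auto simp: R_def)
    then have den: "norm (- cubic (- of_nat k)) \<ge> real k ^ 3 / 8"
      by (simp add: power3_eq_cube)
    have f1: "norm (u + of_nat k + of_nat k) \<le> (norm u + 2) * real k"
    proof -
      have "norm (u + of_nat k + of_nat k) \<le> norm u + real k + real k"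
        by (intro norm_triangle_le add_mono) auto
      also have "\<dots> \<le> (norm u + 2) * real k" using le[of 0 u] by (simp add: algebra_simps)
      finally show ?thesis .
    qed
    have f2: "norm ((u + of_nat k - l) * a + kap k) \<le> ((norm (u - l) + 1) * norm a + 1) * real k"
    proof -
      have eq: "u + of_nat k - l = (u - l) + of_nat k" by simp
      have "norm (u + of_nat k - l) \<le> norm (u - l) + real k"
        unfolding eq using norm_triangle_ineq[of "u - l" "of_nat k"] by simp
      also have "\<dots> \<le> (norm (u - l) + 1) * real k" using le[of 0 "u - l"] by (simp add: algebra_simps)
      finally have "norm ((u + of_nat k - l) * a) \<le> (norm (u - l) + 1) * real k * norm a"
        unfolding norm_mult by (intro mult_right_mono) auto
      then have "norm ((u + of_nat k - l) * a + kap k) \<le> (norm (u - l) + 1) * real k * norm a + real k"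
        using kap k' by (intro norm_triangle_le) linarith
      then show ?thesis by (simp add: algebra_simps)
    qed
    have "pencil (node k) (u + of_nat k) = (u + of_nat k + of_nat k) * ((u + of_nat k - l) * a + kap k)"
      unfolding pencil_node_deflated by (simp add: a_def c_def algebra_simps)
    then have "norm (pencil (node k) (u + of_nat k)) \<le>
        ((norm u + 2) * real k) * (((norm (u - l) + 1) * norm a + 1) * real k)"
      unfolding norm_mult using f1 f2 by (auto intro!: mult_mono simp: norm_mult)
    then have num: "norm (pencil (node k) (u + of_nat k)) \<le> C / 8 * (real k)\<^sup>2"
      by (simp add: C_def power2_eq_square algebra_simps)
    have "norm (pencil (node k) (u + of_nat k) / (- cubic (- of_nat k))) \<le>
        (C / 8 * (real k)\<^sup>2) / (real k ^ 3 / 8)"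
      unfolding norm_divide using num den k' \<open>C \<ge> 0\<close> by (intro frac_le) auto
    also have "\<dots> = C / real k" using k' by (simp add: power2_eq_square power3_eq_cube)
    finally show "norm (pencil (node k) (u + of_nat k) / (- cubic (- of_nat k))) \<le> C / real k" .
  qed
qed

text \<open>
  The sum of the exponents contributes \<open>n\<close> to the power \<open>2 * Re a + Re (u - 2 * l)\<close>, which is exactly inverse to
  the normalisation, and \<open>k\<close> to the power \<open>- 2 * Re a\<close>. One more factor \<open>1 / k\<close> comes from
  the diagonal factor, so the bound is summable and independent of \<open>n\<close>.
\<close>

lemma term_bound:
  obtains k0 C where "k0 \<ge> 1"
    "\<And>k n. k \<ge> k0 \<Longrightarrow> k \<le> n \<Longrightarrow> norm (residue_term n k) \<le> C * real k powr (- 1 - 2 * Re a)"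
proof -
  obtain k1 C1 where 1: "k1 \<ge> 1" "C1 \<ge> 0"
    "\<And>k m. k \<ge> k1 \<Longrightarrow> m \<noteq> k \<Longrightarrow>
      norm (pencil (node k) (u + of_nat m) / (- pencil (node k) (- of_nat m))) \<le>
      exp (Re a * (1 / (real m + real k + 1) + 1 / (real m - real k)) + Re (u - 2 * l) * (1 / real (Suc m))
        + C1 * (1 / real (Suc m) + 1 / \<bar>real m - real k\<bar>)\<^sup>2)"
    using factor_quotient_bound by blast
  obtain k2 C2 where 2: "k2 \<ge> 1" "C2 \<ge> 0"
    "\<And>k. k \<ge> k2 \<Longrightarrow> norm (pencil (node k) (u + of_nat k) / (- cubic (- of_nat k))) \<le> C2 / real k"
    using diagonal_factor_bound by blast
  define Z where "Z = (\<Sum>j. 1 / (real (Suc j))\<^sup>2)"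
  define D where "D = 4 * Re a + 3 * \<bar>Re (u - 2 * l)\<bar> + C1 * (6 * Z)"
  show ?thesis
  proof (rule that[of "max k1 k2" "C2 * exp D"])
    show "max k1 k2 \<ge> 1" using 1 by auto
    fix k n :: nat assume "k \<ge> max k1 k2" and kn: "k \<le> n"
    then have k: "k \<ge> k1" "k \<ge> k2" "k \<ge> 1" using 1 by auto
    have a: "Re a \<ge> 0" using Re_pos by (simp add: a_def)
    define P where "P = (\<Prod>m\<in>{..n}-{k}. pencil (node k) (u + of_nat m) / (- pencil (node k) (- of_nat m)))"
    have "(\<Prod>m\<le>n. pencil (node k) (u + of_nat m)) =
        pencil (node k) (u + of_nat k) * (\<Prod>m\<in>{..n}-{k}. pencil (node k) (u + of_nat m))"
      using kn by (intro prod.remove) auto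
    then have term_eq: "residue_term n k = exp (s * of_real (ln (of_nat n))) *
        (pencil (node k) (u + of_nat k) / (- cubic (- of_nat k))) * P"
      unfolding residue_term_def P_def prod_dividef by simp
    have "norm P \<le> (\<Prod>m\<in>{..n}-{k}. exp (Re a * (1 / (real m + real k + 1) + 1 / (real m - real k)) +
        Re (u - 2 * l) * (1 / real (Suc m)) + C1 * (1 / real (Suc m) + 1 / \<bar>real m - real k\<bar>)\<^sup>2))"
      unfolding P_def prod_norm[symmetric] using k by (intro prod_mono conjI norm_ge_zero 1) auto
    also have "\<dots> = exp ((\<Sum>m\<in>{..n}-{k}. Re a * (1 / (real m + real k + 1) + 1 / (real m - real k)) +
        Re (u - 2 * l) * (1 / real (Suc m))) +
        C1 * (\<Sum>m\<in>{..n}-{k}. (1 / real (Suc m) + 1 / \<bar>real m - real k\<bar>)\<^sup>2))"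
      by (simp only: exp_sum[symmetric] finite_Diff finite_atMost sum.distrib[symmetric] sum_distrib_left)
    also have "\<dots> \<le> exp (((2 * Re a + Re (u - 2 * l)) * ln (real n) - 2 * Re a * ln (real k) +
        4 * Re a + 3 * \<bar>Re (u - 2 * l)\<bar>) + C1 * (6 * Z))"
      unfolding exp_le_cancel_iff Z_def
      by (intro add_mono exponent_sum_bound mult_left_mono sum_inverse_squares_remove_le a k kn 1)
    also have "\<dots> = exp ((2 * Re a + Re (u - 2 * l)) * ln (real n) + (- 2 * Re a * ln (real k) + D))"
      by (simp add: D_def)
    finally have P: "norm P \<le> exp ((2 * Re a + Re (u - 2 * l)) * ln (real n) + (- 2 * Re a * ln (real k) + D))" .
    have s: "Re s = - (2 * Re a + Re (u - 2 * l))" by (simp add: s_def a_def)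
    have "norm (residue_term n k) \<le> exp (Re s * ln (real n)) * (C2 / real k) *
        exp ((2 * Re a + Re (u - 2 * l)) * ln (real n) + (- 2 * Re a * ln (real k) + D))"
      unfolding term_eq norm_mult using 2 k P by (intro mult_mono mult_nonneg_nonneg) auto
    also have "\<dots> = (C2 / real k) * exp (- 2 * Re a * ln (real k) + D)"
      unfolding s by (simp add: exp_add[symmetric] algebra_simps)
    also have "\<dots> = C2 * exp D * (real k powr (- 1) * real k powr (- 2 * Re a))"
    proof -
      have "real k powr (- 1) = 1 / real k" using k by (simp add: powr_minus_divide)
      moreover have "real k powr (- 2 * Re a) = exp (- 2 * Re a * ln (real k))"
        using k by (simp add: powr_def)
      ultimately show ?thesis by (simp only: exp_add) simp
    qed
    also have "\<dots> = C2 * exp D * real k powr (- 1 - 2 * Re a)"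
      unfolding powr_add[symmetric] by simp
    finally show "norm (residue_term n k) \<le> C2 * exp D * real k powr (- 1 - 2 * Re a)" .
  qed
qed

section \<open>The expansion of the gamma product\<close>

theorem gamma_product_expansion:
  "(\<lambda>k. (-1) ^ k / fact k *
     (Gamma (ep k) * Gamma (em k) * rGamma (u + of_nat k) * rGamma (u - ep k) * rGamma (u - em k)) *
     (1 / (x1 + of_nat k) + 1 / (x2 + of_nat k) + 1 / (x3 + of_nat k) - 1 / (l + of_nat k)))
   sums (Gamma x1 * Gamma x2 * Gamma x3 * rGamma (u - x1) * rGamma (u - x2) * rGamma (u - x3))"
  (is "?b sums ?G")
proof -
  obtain k0 C where bound: "k0 \<ge> 1"
    "\<And>k n. k \<ge> k0 \<Longrightarrow> k \<le> n \<Longrightarrow> norm (residue_term n k) \<le> C * real k powr (- 1 - 2 * Re a)"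
    using term_bound by blast
  define M where "M = (\<lambda>k. \<bar>C\<bar> * real k powr (- 1 - 2 * Re a))"
  \<comment> \<open>Padding the finite sums with zeros makes Tannery's theorem applicable.\<close>
  define f where "f = (\<lambda>k n. if k \<le> n then residue_term n k else 0)"
  have sumM: "summable M" unfolding M_def
    using Re_pos by (intro summable_mult) (simp add: summable_real_powr_iff a_def)
  have lim: "(\<lambda>n. f k n) \<longlonglongrightarrow> ?b k" for k
    by (rule Lim_transform_eventually[OF term_limit])
      (use eventually_ge_at_top[of k] in eventually_elim, simp add: f_def)
  have "norm (f k n) \<le> M k" if "k \<ge> k0" for k n
  proof (cases "k \<le> n")
    case True
    have "C * real k powr (- 1 - 2 * Re a) \<le> M k" unfolding M_def by (intro mult_right_mono) auto
    then show ?thesis using bound(2)[OF that True] True by (simp add: f_def)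
  qed (simp add: f_def M_def)
  then have "eventually (\<lambda>(k, n). norm (f k n) \<le> M k) (at_top \<times>\<^sub>F sequentially)"
    unfolding eventually_prod_filter
    by (intro exI[of _ "\<lambda>k. k \<ge> k0"] exI[of _ "\<lambda>_. True"]) (auto simp: eventually_ge_at_top)
  note tannery = tannerys_theorem[OF lim this sumM sequentially_bot]
  have "(\<lambda>n. suminf (\<lambda>k. f k n)) \<longlonglongrightarrow> suminf ?b" and "summable (\<lambda>k. norm (?b k))"
    using tannery by blast+
  moreover have "suminf (\<lambda>k. f k n) = (\<Sum>k\<le>n. residue_term n k)" for n
    by (subst suminf_finite[of "{..n}"]) (auto simp: f_def)
  ultimately have "(\<lambda>n. \<Sum>k\<le>n. residue_term n k) \<longlonglongrightarrow> suminf ?b" by simp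
  from tendsto_add[OF value_at_infinity_limit this] have "suminf ?b = ?G"
    unfolding finite_expansion[symmetric] by (intro LIMSEQ_unique[OF _ value_at_zero_limit]) simp
  moreover have "summable ?b" using \<open>summable (\<lambda>k. norm (?b k))\<close> by (rule summable_norm_cancel)
  ultimately show ?thesis by (simp add: sums_iff)
qed

end

text \<open>
  The numbers under the square root are such that the two eta values satisfy the product relation of the pencil.
\<close>

theorem corollary5p1:
  fixes x1 x2 x3 u l :: complex
  assumes "Re (l + u - (x1 + x2 + x3)) > 0"
    and "x1 \<notin> \<int>\<^sub>\<le>\<^sub>0" and "x2 \<notin> \<int>\<^sub>\<le>\<^sub>0" and "x3 \<notin> \<int>\<^sub>\<le>\<^sub>0" and "l \<notin> \<int>\<^sub>\<le>\<^sub>0"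
    and "\<And>k. eta_plus x1 x2 x3 l k \<notin> \<int>\<^sub>\<le>\<^sub>0"
    and "\<And>k. eta_minus x1 x2 x3 l k \<notin> \<int>\<^sub>\<le>\<^sub>0"
  shows "(\<lambda>k. (-1) ^ k / fact k
            * (Gamma (eta_plus x1 x2 x3 l k) * Gamma (eta_minus x1 x2 x3 l k)
                * rGamma (u + of_nat k)
                * rGamma (u - eta_plus x1 x2 x3 l k) * rGamma (u - eta_minus x1 x2 x3 l k))
            * (1 / (x1 + of_nat k) + 1 / (x2 + of_nat k) + 1 / (x3 + of_nat k)
                - 1 / (l + of_nat k)))
         sums (Gamma x1 * Gamma x2 * Gamma x3
                * rGamma (u - x1) * rGamma (u - x2) * rGamma (u - x3))"
proof -
  have "(l - eta_plus x1 x2 x3 l k) * (l - eta_minus x1 x2 x3 l k) =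
      (l - x1) * (l - x2) * (l - x3) / (l + of_nat k)" for k
  proof -
    define e h where "e = (x1 + x2 + x3 + of_nat k) / 2" and "h = l - e"
    have "(l - eta_plus x1 x2 x3 l k) * (l - eta_minus x1 x2 x3 l k) = h\<^sup>2 - (csqrt (eta_disc x1 x2 x3 l k))\<^sup>2"
      unfolding eta_plus_def eta_minus_def e_def[symmetric] h_def
      by (simp add: power2_eq_square algebra_simps)
    also have "\<dots> = h\<^sup>2 - eta_disc x1 x2 x3 l k" by simp
    also have "h\<^sup>2 = (x1 + x2 + x3 + of_nat k - 2 * l)\<^sup>2 / 4"
      by (simp add: h_def e_def power2_eq_square field_simps)
    also have "\<dots> - eta_disc x1 x2 x3 l k = (l - x1) * (l - x2) * (l - x3) / (l + of_nat k)"
      unfolding eta_disc_def by (simp add: minus_divide_left algebra_simps)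
    finally show ?thesis .
  qed
  moreover have "eta_plus x1 x2 x3 l k + eta_minus x1 x2 x3 l k = x1 + x2 + x3 + of_nat k" for k
    by (simp add: eta_plus_def eta_minus_def)
  ultimately interpret cubic_pencil x1 x2 x3 u l "eta_plus x1 x2 x3 l" "eta_minus x1 x2 x3 l"
    using assms by unfold_locales
  show ?thesis by (rule gamma_product_expansion)
qed

end
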